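(* Let $\Gamma_0=\{\mathcal V_0,\mathcal E_0\}$ be a periodic lattice satisfying assumption (A-6) (as stated in the context), and let $\widehat H=-\widehat\Delta_{\Gamma_0}+\widehat V$ be a discrete Schrödinger operator on it. Then the unique continuation property holds: if $\lambda$ is a constant and $\widehat u:\mathcal V_0\to\mathbf C$ satisfies $(\widehat H-\lambda)\widehat u=0$ on $\mathcal V_0$ and $\widehat u(p_j+\mathbf v(n))=0$ for all $j=1,\dots,s$ and all $n\in\mathbf Z^d$ with $|n|>R$, for some $R>0$, then $\widehat u$ vanishes identically on $\mathcal V_0$.
   Context: **Periodic lattice.** Let $d\ge2$, let $\mathbf v_1,\dots,\mathbf v_d$ be a basis of $\mathbf R^d$, $\mathbf v(n)=\sum_j n_j\mathbf v_j$ for $n\in\mathbf Z^d$, $\mathcal L_0=\{\mathbf v(n):n\in\mathbf Z^d\}$, and let $p_1,\dots,p_s\in\mathbf R^d$ satisfy $p_j-p_k\notin\mathcal L_0$ for $j\ne k$. A periodic lattice is a simple, connected, locally finite graph $\Gamma_0=\{\mathcal V_0,\mathcal E_0\}$ with $\mathcal V_0=\bigcup_{j=1}^s(p_j+\mathcal L_0)$ whose edge set is invariant under translations by $\mathcal L_0$. $|\cdot|$ is the Euclidean norm. **Operators.** $(\widehat\Delta_{\Gamma_0}\widehat u)(v)=\frac1{\deg v}\sum_{w\sim v}\widehat u(w)$, and $\widehat V:\mathcal V_0\to\mathbf R$ acts by multiplication and satisfies $|\widehat V(p_j+\mathbf v(n))|\le Ce^{-\alpha|n|}$ for some constants $C,\alpha>0$.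 **Finite graphs with boundary.** Let $\widetilde\Gamma=\{\widetilde{\mathcal V},\widetilde{\mathcal E}\}$ be a finite graph with $\widetilde{\mathcal V}=\widetilde{\mathcal V}^o\cup\partial\widetilde{\mathcal V}$ a disjoint decomposition into interior and boundary vertices, with no edge of $\widetilde{\mathcal E}$ joining two boundary vertices. Let $d(v,w)$ be the graph distance in $\widetilde\Gamma$ (minimal number of edges of a path). For $S\subset\widetilde{\mathcal V}^o$, a vertex $v\in S$ is an extreme point of $S$ with respect to $\partial\widetilde{\mathcal V}$ if there is $w\in\partial\widetilde{\mathcal V}$ such that $v$ is the unique nearest vertex of $S$ from $w$ with respect to $d$. $\widetilde\Gamma$ satisfies the two-points condition if every $S\subset\widetilde{\mathcal V}^o$ with $\sharp S\ge2$ has at least two extreme points with respect to $\partial\widetilde{\mathcal V}$. **(A-5)** For any $z\in\partial\widetilde{\mathcal V}$ and any distinct $v,w\in\widetilde{\mathcal V}^o$ that are both adjacent to $z$ in $\widetilde{\mathcal E}$, $v$ and $w$ are adjacent in $\widetilde{\mathcal E}$. **(A-6)** For every sufficiently large $R>0$, with $\Omega_R=\bigcup_{j=1}^s\{p_j+\mathbf v(x)\in\mathcal V_0: x\in\mathbf Z^d,\ |x|\le R\}$, there is a finite subgraph $\widetilde\Gamma=\{\widetilde{\mathcal V},\widetilde{\mathcal E}\}$ of $\Gamma_0$ and a disjoint decomposition $\widetilde{\mathcal V}=\widetilde{\mathcal V}^o\cup\partial\widetilde{\mathcal V}$ such that: $\Omega_R\subset\widetilde{\mathcal V}^o$; $\widetilde{\mathcal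 E}$ consists of all edges of $\mathcal E_0$ joining two vertices of $\widetilde{\mathcal V}^o$ and all edges of $\mathcal E_0$ joining a vertex of $\widetilde{\mathcal V}^o$ with a vertex of $\partial\widetilde{\mathcal V}$; and $\widetilde\Gamma$ satisfies the two-points condition and (A-5). *)

theory Defs
  imports "HOL-Analysis.Analysis" "HOL-Library.Extended_Nat"
begin

section \<open>Simple graphs\<close>

definition simple_graph :: "'a set \<Rightarrow> 'a set set \<Rightarrow> bool" where
  "simple_graph V E \<longleftrightarrow> (\<forall>e\<in>E. \<exists>v\<in>V. \<exists>w\<in>V. v \<noteq> w \<and> e = {v, w})"

definition nbrs :: "'a set set \<Rightarrow> 'a \<Rightarrow> 'a set" where
  "nbrs E v = {w. {v, w} \<in> E}"

definition vertex_degree :: "'a set set \<Rightarrow> 'a \<Rightarrow> nat" where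
  "vertex_degree E v = card (nbrs E v)"

definition graph_locally_finite :: "'a set \<Rightarrow> 'a set set \<Rightarrow> bool" where
  "graph_locally_finite V E \<longleftrightarrow> (\<forall>v\<in>V. finite (nbrs E v))"

text \<open>A path is given by its vertices, so it has one edge fewer than the length of the list.
  Repeated vertices are allowed; this affects neither connectedness nor the distance.\<close>

definition graph_path :: "'a set \<Rightarrow> 'a set set \<Rightarrow> 'a \<Rightarrow> 'a list \<Rightarrow> 'a \<Rightarrow> bool" where
  "graph_path V E v xs w \<longleftrightarrow>
     xs \<noteq> [] \<and> hd xs = v \<and> last xs = w \<and> set xs \<subseteq> V \<and> successively (\<lambda>x y. {x, y} \<in> E) xs"

definition graph_connected :: "'a set \<Rightarrow> 'a set set \<Rightarrow> bool" where
  "graph_connected V E \<longleftrightarrow> (\<forall>v\<in>V. \<forall>w\<in>V. \<exists>xs. graph_path V E v xs w)"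

text \<open>Vertices that no path joins are at distance \<open>\<infinity>\<close>.\<close>

definition graph_dist :: "'a set \<Rightarrow> 'a set set \<Rightarrow> 'a \<Rightarrow> 'a \<Rightarrow> enat" where
  "graph_dist V E v w = (INF xs\<in>{xs. graph_path V E v xs w}. enat (length xs - 1))"


section \<open>Finite graphs with boundary\<close>

text \<open>\<open>Vi\<close> and \<open>Vb\<close> are the sets of interior and of boundary vertices.\<close>

definition finite_graph_with_boundary :: "'a set \<Rightarrow> 'a set \<Rightarrow> 'a set set \<Rightarrow> bool" where
  "finite_graph_with_boundary Vi Vb E \<longleftrightarrow>
     finite (Vi \<union> Vb) \<and> Vi \<inter> Vb = {} \<and> simple_graph (Vi \<union> Vb) E \<and>
     (\<forall>v\<in>Vb. \<forall>w\<in>Vb. {v, w} \<notin> E)"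

definition extreme_point :: "'a set \<Rightarrow> 'a set \<Rightarrow> 'a set set \<Rightarrow> 'a set \<Rightarrow> 'a \<Rightarrow> bool" where
  "extreme_point Vi Vb E S v \<longleftrightarrow>
     v \<in> S \<and>
     (\<exists>w\<in>Vb. \<forall>x\<in>S. x \<noteq> v \<longrightarrow> graph_dist (Vi \<union> Vb) E v w < graph_dist (Vi \<union> Vb) E x w)"

definition two_points_condition :: "'a set \<Rightarrow> 'a set \<Rightarrow> 'a set set \<Rightarrow> bool" where
  "two_points_condition Vi Vb E \<longleftrightarrow>
     (\<forall>S. S \<subseteq> Vi \<and> card S \<ge> 2 \<longrightarrow> card {v. extreme_point Vi Vb E S v} \<ge> 2)"

definition assumption_A5 :: "'a set \<Rightarrow> 'a set \<Rightarrow> 'a set set \<Rightarrow> bool" where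
  "assumption_A5 Vi Vb E \<longleftrightarrow>
     (\<forall>z\<in>Vb. \<forall>v\<in>Vi. \<forall>w\<in>Vi. v \<noteq> w \<and> {z, v} \<in> E \<and> {z, w} \<in> E \<longrightarrow> {v, w} \<in> E)"


section \<open>Periodic lattices\<close>

text \<open>The basis vectors are indexed by the finite type \<open>'d\<close>, whose cardinality is the dimension.\<close>

definition lat_vec :: "('d \<Rightarrow> real ^ 'd) \<Rightarrow> int ^ 'd \<Rightarrow> real ^ 'd::finite" where
  "lat_vec b n = (\<Sum>j\<in>UNIV. of_int (n $ j) *\<^sub>R b j)"

definition lat_group :: "('d \<Rightarrow> real ^ 'd) \<Rightarrow> (real ^ 'd::finite) set" where
  "lat_group b = range (lat_vec b)"

definition lat_verts ::
    "('d \<Rightarrow> real ^ 'd) \<Rightarrow> nat \<Rightarrow> (nat \<Rightarrow> real ^ 'd) \<Rightarrow> (real ^ 'd::finite) set" where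
  "lat_verts b s p = (\<Union>j\<in>{1..s}. {p j + l |l. l \<in> lat_group b})"

definition int_norm :: "int ^ 'd::finite \<Rightarrow> real" where
  "int_norm n = norm (\<chi> i. real_of_int (n $ i))"

definition periodic_lattice ::
    "('d \<Rightarrow> real ^ 'd) \<Rightarrow> nat \<Rightarrow> (nat \<Rightarrow> real ^ 'd) \<Rightarrow> (real ^ 'd::finite) set set \<Rightarrow> bool" where
  "periodic_lattice b s p E \<longleftrightarrow>
     inj b \<and> independent (range b) \<and> span (range b) = UNIV \<and>
     s \<ge> 1 \<and>
     (\<forall>j\<in>{1..s}. \<forall>k\<in>{1..s}. j \<noteq> k \<longrightarrow> p j - p k \<notin> lat_group b) \<and>
     simple_graph (lat_verts b s p) E \<and>
     graph_connected (lat_verts b s p) E \<and>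
     graph_locally_finite (lat_verts b s p) E \<and>
     (\<forall>l\<in>lat_group b. (\<lambda>e. (\<lambda>v. v + l) ` e) ` E = E)"

definition lat_ball ::
    "('d \<Rightarrow> real ^ 'd) \<Rightarrow> nat \<Rightarrow> (nat \<Rightarrow> real ^ 'd) \<Rightarrow> real \<Rightarrow> (real ^ 'd::finite) set" where
  "lat_ball b s p R = (\<Union>j\<in>{1..s}. {p j + lat_vec b x |x. int_norm x \<le> R})"

definition assumption_A6 ::
    "('d \<Rightarrow> real ^ 'd) \<Rightarrow> nat \<Rightarrow> (nat \<Rightarrow> real ^ 'd) \<Rightarrow> (real ^ 'd::finite) set set \<Rightarrow> bool" where
  "assumption_A6 b s p E0 \<longleftrightarrow>
     (\<forall>\<^sub>F R in at_top. \<exists>Vi Vb E.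
        Vi \<union> Vb \<subseteq> lat_verts b s p \<and> E \<subseteq> E0 \<and>
        finite_graph_with_boundary Vi Vb E \<and>
        lat_ball b s p R \<subseteq> Vi \<and>
        E = {e \<in> E0. \<exists>v\<in>Vi. \<exists>w\<in>Vi. e = {v, w}} \<union> {e \<in> E0. \<exists>v\<in>Vi. \<exists>w\<in>Vb. e = {v, w}} \<and>
        two_points_condition Vi Vb E \<and>
        assumption_A5 Vi Vb E)"


section \<open>Discrete Schroedinger operators\<close>

text \<open>Functions on the vertex set are represented by total functions on the ambient space, of
  which only the values at vertices matter: at a vertex, both operators below involve no others.\<close>

definition disc_laplacian :: "'a set set \<Rightarrow> ('a \<Rightarrow> complex) \<Rightarrow> 'a \<Rightarrow> complex" where
  "disc_laplacian E u v = 1 / of_nat (vertex_degree E v) * (\<Sum>w\<in>nbrs E v. u w)"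

definition schroedinger :: "'a set set \<Rightarrow> ('a \<Rightarrow> real) \<Rightarrow> ('a \<Rightarrow> complex) \<Rightarrow> 'a \<Rightarrow> complex" where
  "schroedinger E Q u v = - disc_laplacian E u v + of_real (Q v) * u v"

definition exp_decaying ::
    "('d \<Rightarrow> real ^ 'd) \<Rightarrow> nat \<Rightarrow> (nat \<Rightarrow> real ^ 'd) \<Rightarrow> (real ^ 'd::finite \<Rightarrow> real) \<Rightarrow> bool" where
  "exp_decaying b s p Q \<longleftrightarrow>
     (\<exists>C>0. \<exists>\<alpha>>0. \<forall>j\<in>{1..s}. \<forall>n. \<bar>Q (p j + lat_vec b n)\<bar> \<le> C * exp (- \<alpha> * int_norm n))"

end

theory Submission
  imports Defs
begin

text \<open>Let \<open>u\<close> be an eigenfunction with finite non-empty support \<open>S\<close>. It suffices to find a vertex \<open>y\<close> outside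
  \<open>S\<close> with exactly one neighbour \<open>v\<close> in \<open>S\<close>: the equation at \<open>y\<close> then reads \<open>u v = 0\<close>. If \<open>S\<close> has at
  least two elements, choose a finite graph with \<open>S\<close> in its interior and an extreme point \<open>v\<close> of \<open>S\<close>
  that is nearest to the boundary vertex \<open>w\<close>; the second vertex \<open>y\<close> of a shortest path from \<open>v\<close> to \<open>w\<close>
  has the required property. If \<open>S\<close> is a singleton, any neighbour of its element will do.\<close>

lemma nbrs_commute: "w \<in> nbrs E v \<longleftrightarrow> v \<in> nbrs E w"
  by (simp add: nbrs_def insert_commute)

lemma nbrs_subset:
  assumes "simple_graph V E"
  shows "nbrs E v \<subseteq> V - {v}"
  using assms unfolding simple_graph_def nbrs_def by (fastforce simp: doubleton_eq_iff)

lemma graph_path_Cons: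
  assumes "graph_path V E v xs w" and "x \<in> V" and "v \<in> nbrs E x"
  shows "graph_path V E x (x # xs) w"
  using assms by (cases xs) (auto simp: graph_path_def nbrs_def)

lemma graph_path_first_step:
  assumes "graph_path V E v xs w" and "v \<noteq> w"
  obtains y ys where "xs = v # y # ys" "y \<in> nbrs E v" "y \<in> V" "graph_path V E y (y # ys) w"
\<comment> \<open>The rule serves only to split lists into empty, singleton and longer ones; a
  singleton would force \<open>v = w\<close>.\<close>
proof (cases xs rule: remdups_adj.cases)
  case 1
  then show ?thesis using assms by (simp add: graph_path_def)
next
  case (2 x)
  then show ?thesis using assms by (auto simp: graph_path_def)
next
  case (3 x y ys)
  then show ?thesis using assms that[of y ys] by (auto simp: graph_path_def nbrs_def)
qed

lemma graph_dist_le: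
  assumes "graph_path V E v xs w"
  shows "graph_dist V E v w \<le> enat (length xs - 1)"
  unfolding graph_dist_def using assms by (intro INF_lower) simp

text \<open>The infimum over the empty set is \<infinity>, so a finite distance means that some path
  exists; \<open>enat\<close> is well-ordered, so the infimum of a non-empty set is
  attained.\<close>

lemma shortest_graph_path:
  assumes "graph_dist V E v w < \<infinity>"
  obtains xs where "graph_path V E v xs w" "graph_dist V E v w = enat (length xs - 1)"
proof -
  let ?A = "(\<lambda>xs. enat (length xs - 1)) ` {xs. graph_path V E v xs w}"
  have "?A \<noteq> {}"
  proof
    assume "?A = {}"
    then have "graph_dist V E v w = Inf {}"
      unfolding graph_dist_def by (rule arg_cong)
    then show False
      using assms by (simp add: top_enat_def)
  qed
  then have "Inf ?A \<in> ?A"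
    unfolding Inf_enat_def by (metis (mono_tags, lifting) LeastI ex_in_conv)
  then show ?thesis
    using that unfolding graph_dist_def by blast
qed

lemma extreme_point_outer_nbr:
  assumes "extreme_point Vi Vb E S v" and "S \<subseteq> Vi" and "Vi \<inter> Vb = {}" and "S \<noteq> {v}"
  obtains y where "y \<in> Vi \<union> Vb" "y \<notin> S" "nbrs E y \<inter> S = {v}"
proof -
  let ?d = "graph_dist (Vi \<union> Vb) E"
  obtain w where v: "v \<in> S" and w: "w \<in> Vb" and
    nearest: "\<And>x. x \<in> S \<Longrightarrow> x \<noteq> v \<Longrightarrow> ?d v w < ?d x w"
    using assms(1) unfolding extreme_point_def by blast
  obtain x where "x \<in> S" "x \<noteq> v"
    using v assms(4) by blast
  \<comment> \<open>A second point of \<open>S\<close> makes the distance from \<open>v\<close> to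
    \<open>w\<close> finite, as it is strictly below another distance; the finite graph itself may
    be disconnected.\<close>
  then have "?d v w < ?d x w"
    by (rule nearest)
  also have "\<dots> \<le> \<infinity>"
    by simp
  finally obtain xs where xs: "graph_path (Vi \<union> Vb) E v xs w" "?d v w = enat (length xs - 1)"
    by (rule shortest_graph_path)
  have "v \<noteq> w"
    using v w assms by blast
  with xs(1) obtain y ys where y: "xs = v # y # ys" "y \<in> nbrs E v" "y \<in> Vi \<union> Vb"
    and path: "graph_path (Vi \<union> Vb) E y (y # ys) w"
    by (rule graph_path_first_step)
  have dv: "?d v w = enat (Suc (length ys))"
    using xs(2) y(1) by simp
  have "?d y w \<le> enat (length ys)"
    using graph_dist_le[OF path] by simp
  also have "\<dots> < ?d v w"
    using dv by simp
  finally have "y \<notin> S"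
    using nearest by fastforce
  \<comment> \<open>Replacing \<open>v\<close> by \<open>x\<close> at the head of the shortest path
    gives a path of the same length from \<open>x\<close> to \<open>w\<close>, and \<open>v\<close>
    is the unique nearest point.\<close>
  have "x = v" if "x \<in> nbrs E y" "x \<in> S" for x
  proof -
    have "graph_path (Vi \<union> Vb) E x (x # y # ys) w"
      using path that assms(2) by (intro graph_path_Cons) (auto simp: nbrs_commute[of y E x])
    from graph_dist_le[OF this] have "?d x w \<le> ?d v w"
      using dv by simp
    then show "x = v"
      using nearest that(2) by fastforce
  qed
  moreover have "v \<in> nbrs E y"
    using y(2) by (simp add: nbrs_commute[of v E y])
  ultimately have "nbrs E y \<inter> S = {v}"
    using v by blast
  then show ?thesis
    using that \<open>y \<notin> S\<close> y(3) by blast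
qed

text \<open>Where \<open>u\<close> vanishes, only the Laplacian term survives. If the degree is 0,
  finiteness makes the neighbourhood empty and the sum is trivially zero.\<close>

lemma schroedinger_sum_nbrs_zero:
  assumes "schroedinger E Q u y - lam * u y = 0" and "u y = 0"
    and "finite (nbrs E y)"
  shows "(\<Sum>w\<in>nbrs E y. u w) = 0"
  using assms by (auto simp: schroedinger_def disc_laplacian_def vertex_degree_def)

lemma schroedinger_no_single_nbr_in_support:
  assumes "schroedinger E Q u y - lam * u y = 0" and "u y = 0"
    and "finite (nbrs E y)" and "{w \<in> nbrs E y. u w \<noteq> 0} = {v}"
  shows False
proof -
  have "(\<Sum>w\<in>nbrs E y. u w) = (\<Sum>w\<in>{w \<in> nbrs E y. u w \<noteq> 0}. u w)"
    using assms(3) by (intro sum.mono_neutral_right) auto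
  then have "u v = 0"
    using schroedinger_sum_nbrs_zero[OF assms(1-3)] assms(4) by simp
  then show False
    using assms(4) by blast
qed

lemma lat_vec_add: "lat_vec b (m + n) = lat_vec b m + lat_vec b n"
  by (simp add: lat_vec_def sum.distrib scaleR_left_distrib)

lemma lat_vec_axis: "lat_vec b (axis i 1) = b i"
  by (simp add: lat_vec_def axis_def if_distrib if_distribR sum.delta cong: if_cong)

text \<open>Translation by a basis vector yields a second vertex, and connectedness gives a path to
  it; its first step is the neighbour.\<close>

lemma periodic_lattice_nbr:
  fixes b :: "'d::finite \<Rightarrow> real ^ 'd"
  assumes "periodic_lattice b s p E" and "v \<in> lat_verts b s p"
  obtains y where "y \<in> lat_verts b s p" "y \<in> nbrs E v"
proof -
  fix i :: 'd
  have "independent (range b)"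
    using assms(1) by (simp add: periodic_lattice_def)
  then have "b i \<noteq> 0"
    using dependent_zero rangeI[of b i] by metis
  then have "v \<noteq> v + b i"
    by simp
  obtain j n where j: "j \<in> {1..s}" and "v = p j + lat_vec b n"
    using assms(2) unfolding lat_verts_def lat_group_def by blast
  then have "v + b i = p j + lat_vec b (n + axis i 1)"
    by (simp add: lat_vec_add lat_vec_axis)
  with j have "v + b i \<in> lat_verts b s p"
    unfolding lat_verts_def lat_group_def by blast
  moreover have "graph_connected (lat_verts b s p) E"
    using assms(1) by (simp add: periodic_lattice_def)
  ultimately obtain xs where "graph_path (lat_verts b s p) E v xs (v + b i)"
    using assms(2) unfolding graph_connected_def by blast
  then obtain y ys where "y \<in> nbrs E v" "y \<in> lat_verts b s p"
    using \<open>v \<noteq> v + b i\<close> by (blast elim: graph_path_first_step)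
  then show ?thesis
    using that by blast
qed

theorem theorem5p5:
  fixes b :: "'d::finite \<Rightarrow> real ^ 'd"
    and s :: nat
    and p :: "nat \<Rightarrow> real ^ 'd"
    and E0 :: "(real ^ 'd) set set"
    and Q :: "real ^ 'd \<Rightarrow> real"
    and lam :: complex
    and u :: "real ^ 'd \<Rightarrow> complex"
    and R :: real
  assumes "CARD('d) \<ge> 2"
    and "periodic_lattice b s p E0"
    and "assumption_A6 b s p E0"
    and "exp_decaying b s p Q"
    and "\<forall>v\<in>lat_verts b s p. schroedinger E0 Q u v - lam * u v = 0"
    and "R > 0"
    and "\<forall>j\<in>{1..s}. \<forall>n. int_norm n > R \<longrightarrow> u (p j + lat_vec b n) = 0"
  shows "\<forall>v\<in>lat_verts b s p. u v = 0"
proof (rule ccontr)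
  let ?V = "lat_verts b s p"
  define S where "S = {v \<in> ?V. u v \<noteq> 0}"
  assume "\<not> (\<forall>v\<in>?V. u v = 0)"
  then obtain v0 where v0: "v0 \<in> S"
    unfolding S_def by blast
  have simple: "simple_graph ?V E0" and fin: "graph_locally_finite ?V E0"
    using assms(2) by (simp_all add: periodic_lattice_def)
  have outer: False if "y \<in> ?V" "y \<notin> S" "nbrs E0 y \<inter> S = {v}" for y v
  proof -
    \<comment> \<open>\<open>S\<close> contains only vertices, while \<open>u\<close> is defined on
      the whole space; neighbours are vertices, so the two sets agree.\<close>
    have "{w \<in> nbrs E0 y. u w \<noteq> 0} = {v}"
      using that(3) nbrs_subset[OF simple] unfolding S_def by blast
    then show False
      using schroedinger_no_single_nbr_in_support[of E0 Q u y lam v] that(1,2) assms(5) fin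
      unfolding S_def graph_locally_finite_def by blast
  qed
  have "S \<noteq> {v0}"
  proof
    assume S: "S = {v0}"
    obtain y where y: "y \<in> ?V" "y \<in> nbrs E0 v0"
      using periodic_lattice_nbr[OF assms(2)] v0 unfolding S_def by blast
    then have "v0 \<in> nbrs E0 y" "y \<noteq> v0"
      using nbrs_subset[OF simple] by (auto simp: nbrs_commute[of v0 E0 y])
    then show False
      using outer[of y v0] y S by blast
  qed
  \<comment> \<open>The radius can be chosen at least \<open>R\<close>, so that the ball contained
    in \<open>Vi\<close> covers the support \<open>S\<close>.\<close>
  from assms(3) have "\<forall>\<^sub>F r in at_top. r \<ge> R \<and> (\<exists>Vi Vb E.
        Vi \<union> Vb \<subseteq> ?V \<and> E \<subseteq> E0 \<and>
        finite_graph_with_boundary Vi Vb E \<and>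
        lat_ball b s p r \<subseteq> Vi \<and>
        E = {e \<in> E0. \<exists>v\<in>Vi. \<exists>w\<in>Vi. e = {v, w}} \<union> {e \<in> E0. \<exists>v\<in>Vi. \<exists>w\<in>Vb. e = {v, w}} \<and>
        two_points_condition Vi Vb E \<and>
        assumption_A5 Vi Vb E)"
    unfolding assumption_A6_def by (intro eventually_conj eventually_ge_at_top)
  from eventually_happens'[OF trivial_limit_at_top_linorder this]
  obtain r Vi Vb E where r: "r \<ge> R" and VV: "Vi \<union> Vb \<subseteq> ?V"
    and bd: "finite_graph_with_boundary Vi Vb E" and ball: "lat_ball b s p r \<subseteq> Vi"
    and E: "E = {e \<in> E0. \<exists>v\<in>Vi. \<exists>w\<in>Vi. e = {v, w}} \<union> {e \<in> E0. \<exists>v\<in>Vi. \<exists>w\<in>Vb. e = {v, w}}"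
    and two: "two_points_condition Vi Vb E"
    by (elim exE conjE) (rule that)
  have SVi: "S \<subseteq> Vi"
  proof
    fix v assume "v \<in> S"
    then obtain j n where jn: "j \<in> {1..s}" "v = p j + lat_vec b n" "u v \<noteq> 0"
      unfolding S_def lat_verts_def lat_group_def by blast
    then have "int_norm n \<le> r"
      using assms(7) r by force
    then have "v \<in> lat_ball b s p r"
      using jn unfolding lat_ball_def by blast
    then show "v \<in> Vi"
      using ball by blast
  qed
  have "finite S"
    using SVi bd finite_subset unfolding finite_graph_with_boundary_def by blast
  then have "card S \<ge> 2"
    using v0 \<open>S \<noteq> {v0}\<close> card_le_Suc0_iff_eq[of S] by fastforce
  then have "card {v. extreme_point Vi Vb E S v} \<ge> 2"
    using two SVi unfolding two_points_condition_def by blast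
  then have "{v. extreme_point Vi Vb E S v} \<noteq> {}"
    by fastforce
  then obtain v where v: "extreme_point Vi Vb E S v"
    by blast
  moreover have "S \<noteq> {v}"
    using \<open>card S \<ge> 2\<close> by auto
  moreover have "Vi \<inter> Vb = {}"
    using bd unfolding finite_graph_with_boundary_def by blast
  ultimately obtain y where y: "y \<in> Vi \<union> Vb" "y \<notin> S" "nbrs E y \<inter> S = {v}"
    using SVi extreme_point_outer_nbr by metis
  \<comment> \<open>An edge of \<open>E0\<close> between \<open>y\<close> and a point of
    \<open>S\<close> has an endpoint in \<open>Vi\<close> and the other in \<open>Vi\<close> or
    \<open>Vb\<close>, so it belongs to \<open>E\<close>. Thus the equation on the full lattice
    applies at \<open>y\<close>, even if \<open>y\<close> is a boundary vertex.\<close>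
  have "nbrs E y \<inter> S = nbrs E0 y \<inter> S"
    using y(1) SVi unfolding nbrs_def E by (auto simp: doubleton_eq_iff)
  then show False
    using outer y VV by blast
qed

end
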